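(* Let $\alpha$ and $\beta$ be finite words on positive integers. Then $\mathcal T_\alpha=\mathcal T_\beta$ if and only if $s_{[\alpha]}=s_{[\beta]}$.
   Context: A tower diagram is a sequence $\mathcal T=(\mathcal T_1,\mathcal T_2,\ldots)$ of nonnegative integers, almost all zero ($\mathcal T_p$ is the height of the $p$-th tower). Sliding a positive integer $i$ into $\mathcal T$ gives the diagram $i\searrow\mathcal T$ defined as follows: set $s:=i$ and examine towers $p=1,2,3,\ldots$ in order, with $h=\mathcal T_p$: if $s>p+h$, go to the next tower; if $s=p+h$, increase $\mathcal T_p$ by one and stop (addition); if $h\ge1$ and $s=p+h-1$, decrease $\mathcal T_p$ by one and stop (deletion); if $s<p+h-1$, replace $s$ by $s+1$ and go to the next tower. For a word $\alpha=\alpha_1\cdots\alpha_l$ of positive integers, $\alpha\searrow\mathcal T:=\alpha_l\searrow(\cdots\searrow(\alpha_1\searrow\mathcal T))$, and $\mathcal T_\alpha:=\alpha\searrow\varnothing$ where $\varnothing$ is the all-zero diagram. Also $s_{[\alpha]}:=s_{\alpha_1}s_{\alpha_2}\cdots s_{\alpha_l}$, where $s_p$ is the adjacent transposition $(p\ p+1)$. *)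

theory Defs
  imports "HOL-Combinatorics.Transposition"
begin

text \<open>
  Diagrams are functions on \<^typ>\<open>nat\<close> whose value at \<open>p \<ge> 1\<close> is the height of the \<open>p\<close>-th tower;
  the unused position \<open>0\<close> is fixed to \<open>0\<close>, so that equality of diagrams is equality of functions.
\<close>

definition tower_diagram :: "(nat \<Rightarrow> nat) \<Rightarrow> bool" where
  "tower_diagram T \<longleftrightarrow> T 0 = 0 \<and> finite {p. T p \<noteq> 0}"

definition empty_diagram :: "nat \<Rightarrow> nat" where
  "empty_diagram = (\<lambda>_. 0)"

text \<open>
  \<open>slide_from p s T\<close> continues the sliding at tower \<open>p\<close> with current value \<open>s\<close>. A run started
  at tower \<open>1\<close> with a positive value always has \<open>s \<ge> p\<close>, so the final branch is taken exactly
  when \<open>s < p + h - 1\<close>; and it terminates because almost all towers are empty.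
\<close>

partial_function (tailrec) slide_from :: "nat \<Rightarrow> nat \<Rightarrow> (nat \<Rightarrow> nat) \<Rightarrow> (nat \<Rightarrow> nat)" where
  "slide_from p s T =
     (let h = T p in
        if s > p + h then slide_from (p + 1) s T
        else if s = p + h then T(p := h + 1)
        else if h \<ge> 1 \<and> s = p + h - 1 then T(p := h - 1)
        else slide_from (p + 1) (s + 1) T)"

definition slide :: "nat \<Rightarrow> (nat \<Rightarrow> nat) \<Rightarrow> (nat \<Rightarrow> nat)" where
  "slide i T = slide_from 1 i T"

definition slide_word :: "nat list \<Rightarrow> (nat \<Rightarrow> nat) \<Rightarrow> (nat \<Rightarrow> nat)" where
  "slide_word \<alpha> T = fold slide \<alpha> T"

definition word_diagram :: "nat list \<Rightarrow> (nat \<Rightarrow> nat)" where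
  "word_diagram \<alpha> = slide_word \<alpha> empty_diagram"

definition adj_transp :: "nat \<Rightarrow> (nat \<Rightarrow> nat)" where
  "adj_transp p = transpose p (p + 1)"

definition word_perm :: "nat list \<Rightarrow> (nat \<Rightarrow> nat)" where
  "word_perm \<alpha> = foldr (\<lambda>p f. adj_transp p \<circ> f) \<alpha> id"

text \<open>Sliding a positive number always stops, changing exactly one tower height by one.\<close>

lemma slide_from_stops:
  assumes "finite {q. T q \<noteq> 0}" and "p \<le> s"
  shows "\<exists>q\<ge>p. slide_from p s T = T(q := T q + 1) \<or>
               T q \<ge> 1 \<and> slide_from p s T = T(q := T q - 1)"
proof -
  obtain N where "\<forall>q\<in>{q. T q \<noteq> 0}. q < N"
    using assms(1) unfolding finite_nat_set_iff_bounded by blast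
  then have N: "T q = 0" if "q \<ge> N" for q
    using that by force
  show ?thesis
    using assms(2)
  proof (induction "(N - p) + (s - p)" arbitrary: p s rule: less_induct)
    case less
    consider (up) "s > p + T p" | (add) "s = p + T p" | (del) "T p \<ge> 1" "s = p + T p - 1"
      | (pass) "s < p + T p - 1"
      using less.prems by linarith
    then show ?case
    proof cases
      case up
      then have eq: "slide_from p s T = slide_from (p + 1) s T"
        by (subst slide_from.simps) (simp add: Let_def)
      have "(N - (p + 1)) + (s - (p + 1)) < (N - p) + (s - p)" and "p + 1 \<le> s"
        using up by auto
      from less.hyps[OF this] obtain q where "q \<ge> p + 1" and
        "slide_from p s T = T(q := T q + 1) \<or> T q \<ge> 1 \<and> slide_from p s T = T(q := T q - 1)"
        unfolding eq by auto
      then show ?thesis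
        by (intro exI[of _ q]) simp
    next
      case add
      then have "slide_from p s T = T(p := T p + 1)"
        by (subst slide_from.simps) (simp add: Let_def)
      then show ?thesis by blast
    next
      case del
      then have "slide_from p s T = T(p := T p - 1)"
        by (subst slide_from.simps) (auto simp: Let_def)
      with del show ?thesis by blast
    next
      case pass
      then have eq: "slide_from p s T = slide_from (p + 1) (s + 1) T"
        by (subst slide_from.simps) (auto simp: Let_def)
      have "T p \<noteq> 0" using pass less.prems by linarith
      then have "p < N" using N by (meson not_less)
      then have "(N - (p + 1)) + (s + 1 - (p + 1)) < (N - p) + (s - p)" and "p + 1 \<le> s + 1"
        using less.prems by auto
      from less.hyps[OF this] obtain q where "q \<ge> p + 1" and
        "slide_from p s T = T(q := T q + 1) \<or> T q \<ge> 1 \<and> slide_from p s T = T(q := T q - 1)"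
        unfolding eq by auto
      then show ?thesis
        by (intro exI[of _ q]) simp
    qed
  qed
qed

lemma tower_diagram_slide:
  assumes "tower_diagram T" and "i > 0"
  shows "tower_diagram (slide i T)"
proof -
  have fin: "finite {q. T q \<noteq> 0}" and T0: "T 0 = 0"
    using assms(1) by (auto simp: tower_diagram_def)
  have upd: "tower_diagram (T(q := x))" if "q \<ge> 1" for q x
  proof -
    have "{r. (T(q := x)) r \<noteq> 0} \<subseteq> insert q {r. T r \<noteq> 0}" by auto
    then have "finite {r. (T(q := x)) r \<noteq> 0}"
      by (rule finite_subset) (use fin in simp)
    then show ?thesis
      using T0 that by (simp add: tower_diagram_def)
  qed
  have "1 \<le> i" using assms(2) by simp
  from slide_from_stops[OF fin this] obtain q where "q \<ge> 1" and
    "slide i T = T(q := T q + 1) \<or> slide i T = T(q := T q - 1)"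
    unfolding slide_def by blast
  then show ?thesis
    using upd[of q] by (elim disjE) simp_all
qed

lemma tower_diagram_word_diagram:
  assumes "\<forall>i\<in>set \<alpha>. i > 0"
  shows "tower_diagram (word_diagram \<alpha>)"
proof -
  have "tower_diagram (slide_word \<alpha> T)" if "tower_diagram T" for T
    using that assms
    by (induction \<alpha> arbitrary: T) (auto simp: slide_word_def tower_diagram_slide)
  then show ?thesis
    by (simp add: word_diagram_def empty_diagram_def tower_diagram_def)
qed

end

theory Submission imports Defs Complex_Main begin

text \<open>
  Reading tower \<open>p\<close> of height \<open>h\<close> as the cycle \<open>c\<^sub>p = s\<^sub>p s\<^bsub>p+1\<^esub> \<cdots> s\<^bsub>p+h-1\<^esub>\<close>, a diagram encodes the
  permutation \<open>\<cdots> c\<^sub>3 c\<^sub>2 c\<^sub>1\<close>. Sliding \<open>i\<close> is multiplication by \<open>s\<^sub>i\<close> on the right: the four sliding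
  rules are the commutation, extension, cancellation and braid rules for moving \<open>s\<^sub>s\<close> leftwards
  past \<open>c\<^sub>p\<close>. The encoding is injective because \<open>c\<^sub>q\<close> fixes \<open>1\<close> for \<open>q > 1\<close>, so that the preimage
  of \<open>1\<close> is \<open>1 + T\<^sub>1\<close>; cancelling \<open>c\<^sub>1\<close>, one recovers the other heights in the same way.
\<close>

text \<open>The product \<open>c\<^sub>p\<close> in closed form: commutation and braid rules become
  case checks on points, while \<open>tower_cycle_Suc\<close> recovers the factors.\<close>

definition tower_cycle :: "nat \<Rightarrow> nat \<Rightarrow> nat \<Rightarrow> nat" where
  "tower_cycle p h x = (if x = p + h then p else if p \<le> x \<and> x < p + h then x + 1 else x)"

lemma tower_cycle_0 [simp]: "tower_cycle p 0 = id"
  by (auto simp: tower_cycle_def fun_eq_iff)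

lemma tower_cycle_top [simp]: "tower_cycle p h (p + h) = p"
  by (simp add: tower_cycle_def)

lemma tower_cycle_below [simp]: "x < p \<Longrightarrow> tower_cycle p h x = x"
  by (simp add: tower_cycle_def)

lemma bij_adj_transp: "bij (adj_transp p)"
  by (simp add: adj_transp_def)

lemma adj_transp_involutory [simp]: "adj_transp p \<circ> adj_transp p = id"
  by (simp add: adj_transp_def)

lemma tower_cycle_Suc: "tower_cycle p (Suc h) = tower_cycle p h \<circ> adj_transp (p + h)"
  by (auto simp: tower_cycle_def adj_transp_def transpose_def fun_eq_iff)

lemma tower_cycle_commute:
  "s > p + h \<Longrightarrow> tower_cycle p h \<circ> adj_transp s = adj_transp s \<circ> tower_cycle p h"
  by (auto simp: tower_cycle_def adj_transp_def transpose_def fun_eq_iff)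

lemma tower_cycle_delete:
  assumes "h \<ge> 1"
  shows "tower_cycle p h \<circ> adj_transp (p + h - 1) = tower_cycle p (h - 1)"
proof -
  obtain k where h: "h = Suc k"
    using assms by (cases h) auto
  show ?thesis
    by (simp add: h tower_cycle_Suc comp_assoc)
qed

text \<open>Conjugation by the cycle carries the transposition of s and s + 1 to that of their
  images. Since s + 1 < p + h, both points are shifted up by one.\<close>

lemma tower_cycle_braid:
  "p \<le> s \<Longrightarrow> s < p + h - 1 \<Longrightarrow>
    tower_cycle p h \<circ> adj_transp s = adj_transp (s + 1) \<circ> tower_cycle p h"
  by (auto simp: tower_cycle_def adj_transp_def transpose_def fun_eq_iff)

lemma bij_tower_cycle: "bij (tower_cycle p h)"
proof (induction h)
  case (Suc h)
  then show ?case
    unfolding tower_cycle_Suc by (intro bij_comp bij_adj_transp)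
qed (unfold tower_cycle_0, rule bij_id)

text \<open>Truncation to k towers keeps the product finite. Tower p is the rightmost factor,
  because a generator multiplied on the right meets it first.\<close>

fun towers_perm :: "(nat \<Rightarrow> nat) \<Rightarrow> nat \<Rightarrow> nat \<Rightarrow> nat \<Rightarrow> nat" where
  "towers_perm T p 0 = id"
| "towers_perm T p (Suc k) = towers_perm T (Suc p) k \<circ> tower_cycle p (T p)"

lemma bij_towers_perm: "bij (towers_perm T p k)"
  by (induction k arbitrary: p) (simp_all add: bij_comp bij_tower_cycle)

lemma towers_perm_below: "x < p \<Longrightarrow> towers_perm T p k x = x"
  by (induction k arbitrary: p) simp_all

lemma towers_perm_cong:
  "(\<And>q. q \<ge> p \<Longrightarrow> T q = T' q) \<Longrightarrow> towers_perm T p k = towers_perm T' p k"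
  by (induction k arbitrary: p) simp_all

lemma towers_perm_inject:
  assumes "towers_perm T p k = towers_perm T' p k" and "p \<le> q" and "q < p + k"
  shows "T q = T' q"
  using assms
proof (induction k arbitrary: p)
  case (Suc k)
  have top: "towers_perm U p (Suc k) (p + U p) = p" for U
    by (simp add: towers_perm_below)
  \<comment> \<open>The common permutation sends both points to p, so injectivity identifies
    them.\<close>
  have "towers_perm T p (Suc k) (p + T p) = towers_perm T p (Suc k) (p + T' p)"
    unfolding top unfolding Suc.prems(1) top ..
  then have height: "T p = T' p"
    by (metis bij_towers_perm bij_is_inj injD add_left_cancel)
  show ?case
  proof (cases "q = p")
    case False
    \<comment> \<open>Equal heights give equal rightmost factors, which surjectivity
      cancels.\<close>
    have "towers_perm T (Suc p) k = towers_perm T' (Suc p) k"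
      using Suc.prems(1) bij_is_surj[OF bij_tower_cycle, of p "T p"]
      by (auto simp: height fun_eq_iff surj_def) metis
    then show ?thesis
      using Suc.IH[of "Suc p"] Suc.prems False by simp
  qed (simp add: height)
qed simp

lemma slide_from_below:
  assumes "finite {q. T q \<noteq> 0}" and "p \<le> s" and "r < p"
  shows "slide_from p s T r = T r"
  using slide_from_stops[OF assms(1,2)] assms(3) by force

text \<open>
  The bound \<open>p + k\<close> lies beyond the tops of all towers and not only beyond their positions: when
  \<open>s\<close> increases at tower \<open>p\<close> its new value is still below \<open>p + T p\<close>.
\<close>

lemma towers_perm_slide_from:
  assumes "finite {q. T q \<noteq> 0}" and "\<And>q. T q \<noteq> 0 \<Longrightarrow> q + T q \<le> p + k"
    and "p \<le> s" and "s < p + k"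
  shows "towers_perm (slide_from p s T) p k = towers_perm T p k \<circ> adj_transp s"
  using assms(2-)
proof (induction k arbitrary: p s)
  case (Suc k)
  have upd: "towers_perm (T(p := h)) p (Suc k) = towers_perm T (Suc p) k \<circ> tower_cycle p h" for h
    using towers_perm_cong[of "Suc p" "T(p := h)" T k] by simp
  \<comment> \<open>As p + Suc k = Suc p + k, the bound on the tops carries over unchanged.\<close>
  have IH: "towers_perm (slide_from (Suc p) t T) (Suc p) k = towers_perm T (Suc p) k \<circ> adj_transp t"
    if "Suc p \<le> t" "t < Suc p + k" for t
    using Suc.prems(1) that by (intro Suc.IH) auto
  have below: "slide_from (Suc p) t T p = T p" if "Suc p \<le> t" for t
    using slide_from_below[OF assms(1) that] by simp
  consider (up) "s > p + T p" | (add) "s = p + T p" | (del) "T p \<ge> 1" "s = p + T p - 1"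
    | (pass) "s < p + T p - 1"
    using Suc.prems by linarith
  then show ?case
  proof cases
    case up
    then have "slide_from p s T = slide_from (Suc p) s T"
      by (subst slide_from.simps) (simp add: Let_def)
    with up IH[of s] below[of s] tower_cycle_commute[of p "T p" s] Suc.prems show ?thesis
      by (simp add: fun_eq_iff)
  next
    case add
    then have "slide_from p s T = T(p := Suc (T p))"
      by (subst slide_from.simps) (simp add: Let_def)
    with add show ?thesis
      by (simp only: upd, simp only: towers_perm.simps comp_assoc tower_cycle_Suc)
  next
    case del
    then have "slide_from p s T = T(p := T p - 1)"
      by (subst slide_from.simps) (auto simp: Let_def)
    with del tower_cycle_delete[of "T p" p] show ?thesis
      by (simp only: upd, simp only: towers_perm.simps comp_assoc)
  next
    case pass
    then have eq: "slide_from p s T = slide_from (Suc p) (Suc s) T"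
      by (subst slide_from.simps) (auto simp: Let_def)
    have "Suc s < Suc p + k"
      using pass Suc.prems(1)[of p] Suc.prems(2) by (cases "T p = 0") auto
    with eq pass IH[of "Suc s"] below[of "Suc s"] tower_cycle_braid[of p s "T p"] Suc.prems
    show ?thesis
      by (simp add: fun_eq_iff)
  qed
qed simp

text \<open>How large k must be depends on the diagram and on i. With an eventual statement, the
  induction over a word need not track these bounds.\<close>

lemma towers_perm_slide:
  assumes "tower_diagram T" and "i > 0"
  shows "\<forall>\<^sub>F k in sequentially. towers_perm (slide i T) 1 k = towers_perm T 1 k \<circ> adj_transp i"
proof -
  have fin: "finite {q. T q \<noteq> 0}"
    using assms(1) by (simp add: tower_diagram_def)
  then obtain N where N: "\<And>q. T q \<noteq> 0 \<Longrightarrow> q + T q \<le> N"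
    using finite_nat_set_iff_bounded_le[of "(\<lambda>q. q + T q) ` {q. T q \<noteq> 0}"] by auto
  show ?thesis
    using eventually_ge_at_top[of "N + i"]
  proof eventually_elim
    case (elim k)
    then show ?case
      unfolding slide_def using fin assms(2) N
      by (intro towers_perm_slide_from) fastforce+
  qed
qed

lemma towers_perm_word_diagram:
  assumes "\<forall>i\<in>set \<alpha>. i > 0"
  shows "\<forall>\<^sub>F k in sequentially. towers_perm (word_diagram \<alpha>) 1 k = word_perm \<alpha>"
  using assms
proof (induction \<alpha> rule: rev_induct)
  case Nil
  have "towers_perm empty_diagram p k = id" for p k
    by (induction k arbitrary: p) (simp_all add: empty_diagram_def)
  then show ?case
    by (simp add: word_diagram_def slide_word_def word_perm_def)
next
  case (snoc i \<alpha>)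
  have diagram: "word_diagram (\<alpha> @ [i]) = slide i (word_diagram \<alpha>)"
    by (simp add: word_diagram_def slide_word_def)
  \<comment> \<open>The last letter enters \<open>foldr\<close> through its starting value, hence
    the general g.\<close>
  have "foldr (\<lambda>p f. adj_transp p \<circ> f) \<alpha> g = word_perm \<alpha> \<circ> g" for g
    by (induction \<alpha>) (simp_all add: word_perm_def comp_assoc)
  then have perm: "word_perm (\<alpha> @ [i]) = word_perm \<alpha> \<circ> adj_transp i"
    by (simp add: word_perm_def)
  have "\<forall>\<^sub>F k in sequentially. towers_perm (slide i (word_diagram \<alpha>)) 1 k
      = towers_perm (word_diagram \<alpha>) 1 k \<circ> adj_transp i"
    using snoc.prems by (intro towers_perm_slide tower_diagram_word_diagram) auto
  moreover have "\<forall>\<^sub>F k in sequentially. towers_perm (word_diagram \<alpha>) 1 k = word_perm \<alpha>"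
    using snoc by simp
  ultimately show ?case
    unfolding diagram perm by eventually_elim simp
qed

theorem theorem2p1:
  fixes \<alpha> \<beta> :: "nat list"
  assumes "\<forall>i\<in>set \<alpha>. i > 0" and "\<forall>i\<in>set \<beta>. i > 0"
  shows "word_diagram \<alpha> = word_diagram \<beta> \<longleftrightarrow> word_perm \<alpha> = word_perm \<beta>"
proof
  \<comment> \<open>A single k serves both words and also reaches tower q; it may depend on q, since
    diagrams are compared pointwise.\<close>
  have ev: "\<forall>\<^sub>F k in sequentially. q < 1 + k \<and> towers_perm (word_diagram \<alpha>) 1 k = word_perm \<alpha> \<and>
      towers_perm (word_diagram \<beta>) 1 k = word_perm \<beta>" for q
    using towers_perm_word_diagram[OF assms(1)] towers_perm_word_diagram[OF assms(2)]
      eventually_ge_at_top[of q]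
    by eventually_elim simp
  {
    assume "word_diagram \<alpha> = word_diagram \<beta>"
    then show "word_perm \<alpha> = word_perm \<beta>"
      using eventually_happens'[OF sequentially_bot ev[of 0]] by auto
  next
    assume eq: "word_perm \<alpha> = word_perm \<beta>"
    show "word_diagram \<alpha> = word_diagram \<beta>"
    proof
      fix q
      show "word_diagram \<alpha> q = word_diagram \<beta> q"
      proof (cases "q = 0")
        case True
        then show ?thesis
          using assms[THEN tower_diagram_word_diagram] by (simp add: tower_diagram_def)
      next
        case False
        obtain k where "q < 1 + k"
          and "towers_perm (word_diagram \<alpha>) 1 k = towers_perm (word_diagram \<beta>) 1 k"
          using eventually_happens'[OF sequentially_bot ev[of q]] eq by auto
        with False show ?thesis
          by (intro towers_perm_inject[of _ 1 k]) auto
      qed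
    qed
  }
qed

end
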